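(* Let $\{W_1,\ldots,W_f\}$ be a set of mutually quasi-unbiased weighing matrices for parameters $(d,d,d/2,2d)$. Then $f\leq d$.
   Context: A weighing matrix of order $d$ and weight $k$ is a $d\times d$ matrix $W$ with entries in $\{0,\pm1\}$ with $WW^T=kI$. Two weighing matrices $W_1,W_2$ of order $d$ and weight $k$ are quasi-unbiased for parameters $(d,k,l,a)$ (with $a,l$ positive integers) if $\frac{1}{\sqrt a}W_1W_2^T$ is a weighing matrix of weight $l$. A set of weighing matrices is a set of mutually quasi-unbiased weighing matrices for parameters $(d,k,l,a)$ if any two distinct members are quasi-unbiased for parameters $(d,k,l,a)$.
   Formalization: The case d = 2 is excluded, since the claim fails there: for parameters (2,2,1,4), signed row permutations of a Hadamard matrix of order 2 are mutually quasi-unbiased, which gives sets with f = 3 > d. *)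

theory Defs
  imports Complex_Main "Jordan_Normal_Form.Matrix"
begin

definition weighing_matrix :: "nat \<Rightarrow> nat \<Rightarrow> real mat \<Rightarrow> bool" where
  "weighing_matrix d k W \<longleftrightarrow>
     W \<in> carrier_mat d d \<and>
     (\<forall>i<d. \<forall>j<d. W $$ (i, j) \<in> {0, 1, -1}) \<and>
     W * transpose_mat W = real k \<cdot>\<^sub>m 1\<^sub>m d"

definition quasi_unbiased ::
  "nat \<Rightarrow> nat \<Rightarrow> nat \<Rightarrow> nat \<Rightarrow> real mat \<Rightarrow> real mat \<Rightarrow> bool" where
  "quasi_unbiased d k l a W\<^sub>1 W\<^sub>2 \<longleftrightarrow>
     0 < l \<and> 0 < a \<and>
     weighing_matrix d k W\<^sub>1 \<and> weighing_matrix d k W\<^sub>2 \<and>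
     weighing_matrix d l ((1 / sqrt (real a)) \<cdot>\<^sub>m (W\<^sub>1 * transpose_mat W\<^sub>2))"

text \<open>The conjuncts beyond \<open>pairwise\<close> matter only for sets with at most one element,
  where they keep the members weighing matrices and the parameters positive.\<close>

definition mutually_quasi_unbiased ::
  "nat \<Rightarrow> nat \<Rightarrow> nat \<Rightarrow> nat \<Rightarrow> real mat set \<Rightarrow> bool" where
  "mutually_quasi_unbiased d k l a S \<longleftrightarrow>
     0 < l \<and> 0 < a \<and>
     (\<forall>W\<in>S. weighing_matrix d k W) \<and>
     pairwise (quasi_unbiased d k l a) S"

text \<open>For \<open>d = 2\<close> the parameters \<open>(d, d, d/2, 2d) = (2, 2, 1, 4)\<close> are degenerate: a weighing
  matrix of weight 1 is a signed permutation matrix, so \<open>W\<close> is quasi-unbiased with every matrix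
  obtained from it by permuting and negating rows. Hence the bound \<open>f \<le> d\<close> fails there.\<close>

lemma order_two_exceeds_bound:
  "\<exists>W :: nat \<Rightarrow> real mat. inj_on W {1..3} \<and> mutually_quasi_unbiased 2 2 1 4 (W ` {1..3})"
proof -
  define A B C :: "real mat" where
    "A = mat_of_rows_list 2 [[1, 1], [1, -1]]"
    and "B = mat_of_rows_list 2 [[1, -1], [1, 1]]"
    and "C = mat_of_rows_list 2 [[-1, -1], [1, -1]]"
  note defs = A_def B_def C_def
  have lt2: "i < 2 \<longleftrightarrow> i = 0 \<or> i = Suc 0" for i :: nat by auto
  note ev = weighing_matrix_def mat_eq_iff mat_of_rows_list_def scalar_prod_def lt2
    numeral_2_eq_2 all_conj_distrib
  have ne: "A \<noteq> B" "A \<noteq> C" "B \<noteq> C"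
    by (auto simp: defs mat_eq_iff mat_of_rows_list_def numeral_2_eq_2 less_Suc_eq
        conj_disj_distribR ex_disj_distrib)
  have w: "weighing_matrix 2 2 A" "weighing_matrix 2 2 B" "weighing_matrix 2 2 C"
    by (auto simp: defs ev less_Suc_eq)
  have s: "sqrt 4 = 2" by simp
  have p: "weighing_matrix 2 1 ((1 / 2) \<cdot>\<^sub>m (X * transpose_mat Y))"
    if "X \<in> {A, B, C}" "Y \<in> {A, B, C}" for X Y
    using that by (auto simp: defs ev less_Suc_eq)
  define W where "W = (\<lambda>i::nat. if i = 1 then A else if i = 2 then B else C)"
  have I: "{1..3} = {1, 2, 3::nat}" by auto
  have "W ` {1..3} = {A, B, C}" unfolding I by (auto simp: W_def)
  moreover have "inj_on W {1..3}" unfolding I using ne by (auto simp: W_def inj_on_def)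
  moreover have "mutually_quasi_unbiased 2 2 1 4 {A, B, C}"
    unfolding mutually_quasi_unbiased_def pairwise_def quasi_unbiased_def
    using w p s by auto
  ultimately show ?thesis by metis
qed

end

theory Submission imports Defs begin

text \<open>The rows of \<open>W\<^sub>1, \<dots>, W\<^sub>f\<close> form \<open>f d\<close> sign vectors of length \<open>d\<close> in which
  distinct members have inner product \<open>t\<close> equal to \<open>0\<close> or \<open>\<plusminus>\<surd>(2 d)\<close>.
  Delsarte's linear programming method applies with the polynomial \<open>F(t) = t\<^sup>2 (t\<^sup>2 - 2 d)\<close>,
  which vanishes at these values. Its expansion in (unnormalised) Krawtchouk polynomials is
  \<open>F = P\<^sub>4 + 4 (d - 2) P\<^sub>2 + d (d - 2)\<close>, where \<open>P\<^sub>2\<close> and \<open>P\<^sub>4\<close> are the sums of the products of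
  the \<open>x\<^sub>i y\<^sub>i\<close> over pairs and quadruples of distinct indices, hence positive semidefinite
  kernels. Summing over all ordered pairs of rows, with \<open>N = f d\<close>, gives
  \<open>N F(d) \<ge> N\<^sup>2 d (d - 2)\<close>, that is \<open>N \<le> d\<^sup>2\<close>.\<close>

section \<open>Positive semidefinite kernels\<close>

text \<open>Since \<open>S\<close> depends on neither \<open>p\<close> nor \<open>q\<close>, its sum
  can be moved outermost. Repeated use peels off the index sums of P_2 and P_4 one by one, until a
  single monomial kernel remains.\<close>

lemma sum_sum_sum_nonneg:
  fixes K :: "'s \<Rightarrow> 'p \<Rightarrow> 'q \<Rightarrow> real"
  assumes "\<And>s. s \<in> S \<Longrightarrow> 0 \<le> (\<Sum>p\<in>I. \<Sum>q\<in>J. K s p q)"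
  shows "0 \<le> (\<Sum>p\<in>I. \<Sum>q\<in>J. \<Sum>s\<in>S. K s p q)"
proof -
  have "(\<Sum>p\<in>I. \<Sum>q\<in>J. \<Sum>s\<in>S. K s p q) = (\<Sum>p\<in>I. \<Sum>s\<in>S. \<Sum>q\<in>J. K s p q)"
    by (intro sum.cong refl sum.swap)
  also have "\<dots> = (\<Sum>s\<in>S. \<Sum>p\<in>I. \<Sum>q\<in>J. K s p q)"
    by (rule sum.swap)
  finally show ?thesis
    using assms by (simp add: sum_nonneg)
qed

lemma sum_sum_rank_one_nonneg:
  fixes \<phi> :: "'p \<Rightarrow> real"
  shows "0 \<le> (\<Sum>p\<in>I. \<Sum>q\<in>I. \<phi> p * \<phi> q)"
  by (simp flip: sum_product)

section \<open>Krawtchouk polynomials as sums over distinct indices\<close>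

text \<open>Stated over the reals so that the counts n - 1 and n - 2 below involve no truncated
  subtraction.\<close>

lemma real_card_Diff_singleton:
  assumes "finite A" "i \<in> A"
  shows "real (card (A - {i})) = real (card A) - 1"
  using card.remove[OF assms] by simp

text \<open>The diagonal of the squared sum contributes 1 for each index. For \<open>a i\<close> the
  product of the i-th entries of two sign vectors, \<open>sum a A\<close> is their inner product t,
  and this is P_2(t) = t^2 - n.\<close>

lemma sum_distinct_pairs:
  fixes a :: "'i \<Rightarrow> real"
  assumes "finite A" and "\<And>i. i \<in> A \<Longrightarrow> a i * a i = 1"
  shows "(\<Sum>i\<in>A. \<Sum>j\<in>A-{i}. a i * a j) = (sum a A)\<^sup>2 - real (card A)"
proof -
  have "(\<Sum>j\<in>A-{i}. a i * a j) = a i * sum a A - 1" if "i \<in> A" for i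
    using that assms by (simp add: sum_diff1 right_diff_distrib flip: sum_distrib_left)
  then show ?thesis
    by (simp add: sum_subtractf power2_eq_square flip: sum_distrib_right)
qed

text \<open>Each innermost sum is t minus the excluded terms, and an excluded term meets its own
  copy in a square equal to 1. This yields the recurrence P_3 = t P_2 - 2 (n - 1) P_1.\<close>

lemma sum_distinct_triples:
  fixes a :: "'i \<Rightarrow> real"
  assumes "finite A" and sq: "\<And>i. i \<in> A \<Longrightarrow> a i * a i = 1"
  shows "(\<Sum>i\<in>A. \<Sum>j\<in>A-{i}. \<Sum>k\<in>A-{i}-{j}. a i * a j * a k) =
    sum a A * ((sum a A)\<^sup>2 - real (card A)) - 2 * (real (card A) - 1) * sum a A"
proof -
  define t where "t = sum a A"
  define n where "n = real (card A)"
  have inner: "(\<Sum>k\<in>A-{i}-{j}. a i * a j * a k) = t * (a i * a j) - a j - a i"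
    if "i \<in> A" "j \<in> A-{i}" for i j
  proof -
    have "(\<Sum>k\<in>A-{i}-{j}. a i * a j * a k) = a i * a j * (t - a i - a j)"
      using that assms(1) by (simp add: sum_diff1 t_def flip: sum_distrib_left)
    also have "\<dots> = t * (a i * a j) - (a i * a i) * a j - a i * (a j * a j)"
      by (simp add: algebra_simps)
    finally show ?thesis
      using that sq by simp
  qed
  have card: "real (card (A-{i})) = n - 1" if "i \<in> A" for i
    using that assms(1) by (simp add: n_def real_card_Diff_singleton del: card_Diff_singleton card_Diff_insert)
  have middle: "(\<Sum>j\<in>A-{i}. \<Sum>k\<in>A-{i}-{j}. a i * a j * a k) =
      t * (\<Sum>j\<in>A-{i}. a i * a j) - (t - a i) - (n - 1) * a i" if "i \<in> A" for i
  proof -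
    have "(\<Sum>j\<in>A-{i}. \<Sum>k\<in>A-{i}-{j}. a i * a j * a k) =
        (\<Sum>j\<in>A-{i}. t * (a i * a j) - a j - a i)"
      using that by (intro sum.cong refl inner) auto
    also have "\<dots> = t * (\<Sum>j\<in>A-{i}. a i * a j) - sum a (A-{i}) - real (card (A-{i})) * a i"
      by (simp add: sum_subtractf sum_distrib_left)
    finally show ?thesis
      using that assms(1) card by (simp add: sum_diff1 t_def)
  qed
  have pairs: "(\<Sum>i\<in>A. \<Sum>j\<in>A-{i}. a i * a j) = t\<^sup>2 - n"
    unfolding t_def n_def using assms by (rule sum_distinct_pairs)
  have "(\<Sum>i\<in>A. \<Sum>j\<in>A-{i}. \<Sum>k\<in>A-{i}-{j}. a i * a j * a k) =
      (\<Sum>i\<in>A. t * (\<Sum>j\<in>A-{i}. a i * a j) - (t - a i) - (n - 1) * a i)"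
    by (intro sum.cong refl middle)
  also have "\<dots> = t * (\<Sum>i\<in>A. \<Sum>j\<in>A-{i}. a i * a j) - (n * t - t) - (n - 1) * t"
    by (simp only: sum_subtractf sum_constant t_def n_def flip: sum_distrib_left)
  also have "\<dots> = t * (t\<^sup>2 - n) - 2 * (n - 1) * t"
    unfolding pairs by (simp add: algebra_simps)
  finally show ?thesis
    by (simp only: t_def n_def)
qed

text \<open>The same elimination one level deeper, in effect P_4 = t P_3 - 3 (n - 2) P_2.\<close>

lemma sum_distinct_quadruples:
  fixes a :: "'i \<Rightarrow> real"
  assumes fin: "finite A" and sq: "\<And>i. i \<in> A \<Longrightarrow> a i * a i = 1"
  shows "(\<Sum>i\<in>A. \<Sum>j\<in>A-{i}. \<Sum>k\<in>A-{i}-{j}. \<Sum>l\<in>A-{i}-{j}-{k}. a i * a j * a k * a l) =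
    sum a A ^ 4 - (6 * real (card A) - 8) * (sum a A)\<^sup>2 + 3 * real (card A) * (real (card A) - 2)"
proof -
  define t where "t = sum a A"
  define n where "n = real (card A)"
  have inner: "(\<Sum>l\<in>A-{i}-{j}-{k}. a i * a j * a k * a l) =
      t * (a i * a j * a k) - a j * a k - a i * a k - a i * a j"
    if "i \<in> A" "j \<in> A-{i}" "k \<in> A-{i}-{j}" for i j k
  proof -
    have "(\<Sum>l\<in>A-{i}-{j}-{k}. a i * a j * a k * a l) = a i * a j * a k * (t - a i - a j - a k)"
      using that fin by (simp add: sum_diff1 t_def flip: sum_distrib_left)
    also have "\<dots> = t * (a i * a j * a k) - (a i * a i) * (a j * a k)
        - (a j * a j) * (a i * a k) - (a k * a k) * (a i * a j)"
      by (simp add: algebra_simps)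
    finally show ?thesis
      using that sq by simp
  qed
  have card1: "real (card (A-{i})) = n - 1" if "i \<in> A" for i
    using that fin by (simp add: n_def real_card_Diff_singleton del: card_Diff_singleton card_Diff_insert)
  have card2: "real (card (A-{i}-{j})) = n - 2" if "i \<in> A" "j \<in> A-{i}" for i j
    using that fin by (simp add: n_def real_card_Diff_singleton del: card_Diff_singleton card_Diff_insert)
  have middle: "(\<Sum>k\<in>A-{i}-{j}. \<Sum>l\<in>A-{i}-{j}-{k}. a i * a j * a k * a l) =
      t * (\<Sum>k\<in>A-{i}-{j}. a i * a j * a k) - a j * (t - a i - a j) - a i * (t - a i - a j)
        - (n - 2) * (a i * a j)"
    if "i \<in> A" "j \<in> A-{i}" for i j
  proof -
    have "(\<Sum>k\<in>A-{i}-{j}. \<Sum>l\<in>A-{i}-{j}-{k}. a i * a j * a k * a l) =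
        (\<Sum>k\<in>A-{i}-{j}. t * (a i * a j * a k) - a j * a k - a i * a k - a i * a j)"
      using that by (intro sum.cong refl inner) auto
    also have "\<dots> = t * (\<Sum>k\<in>A-{i}-{j}. a i * a j * a k) - a j * sum a (A-{i}-{j})
        - a i * sum a (A-{i}-{j}) - real (card (A-{i}-{j})) * (a i * a j)"
      by (simp add: sum_subtractf sum_distrib_left)
    finally show ?thesis
      using that fin card2[OF that] by (simp add: sum_diff1 t_def)
  qed
  \<comment> \<open>Expanding, the two squares give the constant 2, and the two cross terms
    \<open>a i * a j\<close> lower the coefficient n - 2 to n - 4.\<close>
  have middle': "(\<Sum>k\<in>A-{i}-{j}. \<Sum>l\<in>A-{i}-{j}-{k}. a i * a j * a k * a l) =
      t * (\<Sum>k\<in>A-{i}-{j}. a i * a j * a k) - t * a j - t * a i + 2 - (n - 4) * (a i * a j)"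
    if "i \<in> A" "j \<in> A-{i}" for i j
  proof -
    have "a i * a i = 1" "a j * a j = 1"
      using that sq by auto
    then show ?thesis
      unfolding middle[OF that] by (simp add: algebra_simps)
  qed
  have outer: "(\<Sum>j\<in>A-{i}. \<Sum>k\<in>A-{i}-{j}. \<Sum>l\<in>A-{i}-{j}-{k}. a i * a j * a k * a l) =
      t * (\<Sum>j\<in>A-{i}. \<Sum>k\<in>A-{i}-{j}. a i * a j * a k) - t * (t - a i) - (n - 1) * (t * a i)
        + 2 * (n - 1) - (n - 4) * (\<Sum>j\<in>A-{i}. a i * a j)" if "i \<in> A" for i
  proof -
    have "(\<Sum>j\<in>A-{i}. \<Sum>k\<in>A-{i}-{j}. \<Sum>l\<in>A-{i}-{j}-{k}. a i * a j * a k * a l) =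
        (\<Sum>j\<in>A-{i}. t * (\<Sum>k\<in>A-{i}-{j}. a i * a j * a k) - t * a j - t * a i + 2
          - (n - 4) * (a i * a j))"
      using that by (intro sum.cong refl middle') auto
    also have "\<dots> = t * (\<Sum>j\<in>A-{i}. \<Sum>k\<in>A-{i}-{j}. a i * a j * a k) - t * sum a (A-{i})
        - real (card (A-{i})) * (t * a i) + 2 * real (card (A-{i}))
        - (n - 4) * (\<Sum>j\<in>A-{i}. a i * a j)"
      by (simp only: sum_subtractf sum.distrib sum_distrib_left sum_constant mult.commute[of 2])
    finally show ?thesis
      using that fin card1[OF that] by (simp add: sum_diff1 t_def)
  qed
  have pairs: "(\<Sum>i\<in>A. \<Sum>j\<in>A-{i}. a i * a j) = t\<^sup>2 - n"
    unfolding t_def n_def using fin sq by (rule sum_distinct_pairs)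
  have triples: "(\<Sum>i\<in>A. \<Sum>j\<in>A-{i}. \<Sum>k\<in>A-{i}-{j}. a i * a j * a k) =
      t * (t\<^sup>2 - n) - 2 * (n - 1) * t"
    unfolding t_def n_def using fin sq by (rule sum_distinct_triples)
  have "(\<Sum>i\<in>A. \<Sum>j\<in>A-{i}. \<Sum>k\<in>A-{i}-{j}. \<Sum>l\<in>A-{i}-{j}-{k}. a i * a j * a k * a l) =
      (\<Sum>i\<in>A. t * (\<Sum>j\<in>A-{i}. \<Sum>k\<in>A-{i}-{j}. a i * a j * a k) - t * (t - a i)
        - (n - 1) * (t * a i) + 2 * (n - 1) - (n - 4) * (\<Sum>j\<in>A-{i}. a i * a j))"
    by (intro sum.cong refl outer)
  also have "\<dots> = t * (\<Sum>i\<in>A. \<Sum>j\<in>A-{i}. \<Sum>k\<in>A-{i}-{j}. a i * a j * a k) - t * (n * t - t)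
        - (n - 1) * (t * t) + n * (2 * (n - 1)) - (n - 4) * (\<Sum>i\<in>A. \<Sum>j\<in>A-{i}. a i * a j)"
    by (simp only: sum_subtractf sum.distrib sum_constant t_def n_def flip: sum_distrib_left)
  also have "\<dots> = t ^ 4 - (6 * n - 8) * t\<^sup>2 + 3 * n * (n - 2)"
    unfolding pairs triples
    by (simp add: algebra_simps power2_eq_square power4_eq_xxxx)
  finally show ?thesis
    by (simp only: t_def n_def)
qed

section \<open>The linear programming bound for sign vectors\<close>

text \<open>Counting indices already counts vectors: a repeated vector would have squared inner
  product n^2, which is neither 0 nor 2n when n > 2.\<close>

lemma card_sign_vectors_le:
  fixes x :: "'p \<Rightarrow> 'i \<Rightarrow> real"
  assumes finI: "finite I" and finA: "finite A" and d: "2 < card A"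
    and sq: "\<And>p i. p \<in> I \<Longrightarrow> i \<in> A \<Longrightarrow> x p i * x p i = 1"
    and ip: "\<And>p q. p \<in> I \<Longrightarrow> q \<in> I \<Longrightarrow> p \<noteq> q \<Longrightarrow>
      (\<Sum>i\<in>A. x p i * x q i)\<^sup>2 \<in> {0, 2 * real (card A)}"
  shows "card I \<le> (card A)\<^sup>2"
proof -
  define g where "g p q = (\<Sum>i\<in>A. x p i * x q i)" for p q
  define n where "n = real (card A)"
  define N where "N = real (card I)"
  have sq': "(x p i * x q i) * (x p i * x q i) = 1" if "p \<in> I" "q \<in> I" "i \<in> A" for p q i
  proof -
    have "(x p i * x q i) * (x p i * x q i) = (x p i * x p i) * (x q i * x q i)"
      by (simp add: algebra_simps)
    then show ?thesis
      using that sq by simp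
  qed
  have P2: "0 \<le> (\<Sum>p\<in>I. \<Sum>q\<in>I. (g p q)\<^sup>2 - n)"
  proof -
    have "0 \<le> (\<Sum>p\<in>I. \<Sum>q\<in>I. \<Sum>i\<in>A. \<Sum>j\<in>A-{i}. (x p i * x q i) * (x p j * x q j))"
    proof (intro sum_sum_sum_nonneg)
      fix i j
      \<comment> \<open>For fixed indices the kernel separates into a factor in \<open>p\<close>
        times the same factor in \<open>q\<close>, so its double sum is a square.\<close>
      show "0 \<le> (\<Sum>p\<in>I. \<Sum>q\<in>I. (x p i * x q i) * (x p j * x q j))"
        using sum_sum_rank_one_nonneg[of "\<lambda>p. x p i * x p j" I] by (simp add: mult_ac)
    qed
    also have "\<dots> = (\<Sum>p\<in>I. \<Sum>q\<in>I. (g p q)\<^sup>2 - n)"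
      unfolding g_def n_def
      by (intro sum.cong refl sum_distinct_pairs finA sq') auto
    finally show ?thesis .
  qed
  have P4: "0 \<le> (\<Sum>p\<in>I. \<Sum>q\<in>I. g p q ^ 4 - (6 * n - 8) * (g p q)\<^sup>2 + 3 * n * (n - 2))"
  proof -
    have "0 \<le> (\<Sum>p\<in>I. \<Sum>q\<in>I. \<Sum>i\<in>A. \<Sum>j\<in>A-{i}. \<Sum>k\<in>A-{i}-{j}. \<Sum>l\<in>A-{i}-{j}-{k}.
        (x p i * x q i) * (x p j * x q j) * (x p k * x q k) * (x p l * x q l))"
    proof (intro sum_sum_sum_nonneg)
      fix i j k l
      show "0 \<le> (\<Sum>p\<in>I. \<Sum>q\<in>I. (x p i * x q i) * (x p j * x q j) * (x p k * x q k) * (x p l * x q l))"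
        using sum_sum_rank_one_nonneg[of "\<lambda>p. x p i * x p j * x p k * x p l" I]
        by (simp add: mult_ac)
    qed
    also have "\<dots> = (\<Sum>p\<in>I. \<Sum>q\<in>I. g p q ^ 4 - (6 * n - 8) * (g p q)\<^sup>2 + 3 * n * (n - 2))"
      unfolding g_def n_def
      by (intro sum.cong refl sum_distinct_quadruples finA sq') auto
    finally show ?thesis .
  qed
  have n: "2 < n"
    using d by (simp add: n_def)
  \<comment> \<open>The multiplier 4 (n - 2) changes the quadratic coefficient from -(6n - 8) to -2n
    and the constant from 3n(n - 2) to -n(n - 2), which leaves F(t) - n(n - 2).\<close>
  have "0 \<le> (\<Sum>p\<in>I. \<Sum>q\<in>I. g p q ^ 4 - (6 * n - 8) * (g p q)\<^sup>2 + 3 * n * (n - 2))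
      + 4 * (n - 2) * (\<Sum>p\<in>I. \<Sum>q\<in>I. (g p q)\<^sup>2 - n)"
    using P2 P4 n by simp
  also have "\<dots> = (\<Sum>p\<in>I. \<Sum>q\<in>I. (g p q)\<^sup>2 * ((g p q)\<^sup>2 - 2 * n) - n * (n - 2))"
    unfolding sum_distrib_left sum.distrib[symmetric]
    by (intro sum.cong refl) (simp add: algebra_simps power2_eq_square power4_eq_xxxx)
  \<comment> \<open>Off the diagonal F vanishes by \<open>ip\<close>; on it the inner product is
    n.\<close>
  also have "\<dots> = (\<Sum>p\<in>I. \<Sum>q\<in>I. (if p = q then n\<^sup>2 * (n\<^sup>2 - 2 * n) else 0) - n * (n - 2))"
  proof (intro sum.cong refl)
    fix p q assume pq: "p \<in> I" "q \<in> I"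
    have "g q q = n"
      using pq sq by (simp add: g_def n_def)
    moreover have "p \<noteq> q \<Longrightarrow> (g p q)\<^sup>2 * ((g p q)\<^sup>2 - 2 * n) = 0"
      using ip[OF pq] by (auto simp: g_def n_def)
    ultimately show "(g p q)\<^sup>2 * ((g p q)\<^sup>2 - 2 * n) - n * (n - 2) =
        (if p = q then n\<^sup>2 * (n\<^sup>2 - 2 * n) else 0) - n * (n - 2)"
      by simp
  qed
  also have "\<dots> = N * (n\<^sup>2 * (n\<^sup>2 - 2 * n)) - N * (N * (n * (n - 2)))"
    using finI by (simp add: sum_subtractf N_def right_diff_distrib)
  also have "\<dots> = (N * (n * (n - 2))) * (n\<^sup>2 - N)"
    by (simp add: algebra_simps power2_eq_square)
  finally have "0 \<le> (N * (n * (n - 2))) * (n\<^sup>2 - N)" .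
  \<comment> \<open>Here n > 2 allows the common factor to be cancelled; an empty family is treated
    apart.\<close>
  moreover have "0 < N * (n * (n - 2))" if "N \<noteq> 0"
    using that n by (simp add: N_def)
  ultimately have "N \<le> n\<^sup>2"
    by (cases "N = 0") (auto simp: zero_le_mult_iff)
  then show ?thesis
    by (simp add: N_def n_def flip: of_nat_power)
qed

section \<open>Inner products of rows of weighing matrices\<close>

lemma mult_transpose_mat_index:
  fixes X Y :: "real mat"
  assumes "X \<in> carrier_mat d d" "Y \<in> carrier_mat d d" "r < d" "s < d"
  shows "(X * transpose_mat Y) $$ (r, s) = (\<Sum>i<d. X $$ (r, i) * Y $$ (s, i))"
  using assms by (auto simp: scalar_prod_def lessThan_atLeast0 intro!: sum.cong)

lemma weighing_matrix_rows:
  assumes "weighing_matrix d k W" "r < d" "s < d"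
  shows "(\<Sum>i<d. W $$ (r, i) * W $$ (s, i)) = (if r = s then real k else 0)"
proof -
  have "(W * transpose_mat W) $$ (r, s) = (real k \<cdot>\<^sub>m 1\<^sub>m d) $$ (r, s)"
    using assms by (simp only: weighing_matrix_def)
  then show ?thesis
    using assms mult_transpose_mat_index[of W d W r s]
    by (auto simp: weighing_matrix_def split: if_splits)
qed

text \<open>The squares of the d entries of a row are at most 1 and sum to the weight d, so each
  equals 1.\<close>

lemma weighing_matrix_full_weight_entry_square:
  assumes W: "weighing_matrix d d W" and r: "r < d" and i: "i < d"
  shows "W $$ (r, i) * W $$ (r, i) = 1"
proof -
  have "(\<Sum>i<d. 1 - W $$ (r, i) * W $$ (r, i)) = 0"
    using weighing_matrix_rows[OF W r r] by (simp add: sum_subtractf)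
  moreover have "0 \<le> 1 - W $$ (r, i) * W $$ (r, i)" if "i < d" for i
  proof -
    have "W $$ (r, i) \<in> {0, 1, -1}"
      using W r that by (simp add: weighing_matrix_def)
    then show ?thesis
      by auto
  qed
  ultimately have "\<forall>i\<in>{..<d}. 1 - W $$ (r, i) * W $$ (r, i) = 0"
    by (subst (asm) sum_nonneg_eq_0_iff) auto
  then show ?thesis
    using i by simp
qed

lemma quasi_unbiased_rows:
  assumes "quasi_unbiased d k l a X Y" "r < d" "s < d"
  shows "(\<Sum>i<d. X $$ (r, i) * Y $$ (s, i))\<^sup>2 \<in> {0, real a}"
proof -
  have X: "X \<in> carrier_mat d d" and Y: "Y \<in> carrier_mat d d" and a: "0 < a"
    using assms by (auto simp: quasi_unbiased_def weighing_matrix_def)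
  define g where "g = (\<Sum>i<d. X $$ (r, i) * Y $$ (s, i))"
  have "((1 / sqrt (real a)) \<cdot>\<^sub>m (X * transpose_mat Y)) $$ (r, s) \<in> {0, 1, -1}"
    using assms unfolding quasi_unbiased_def weighing_matrix_def by blast
  moreover have "((1 / sqrt (real a)) \<cdot>\<^sub>m (X * transpose_mat Y)) $$ (r, s) = g / sqrt (real a)"
    using X Y assms(2,3) mult_transpose_mat_index[OF X Y assms(2,3)] by (simp add: g_def)
  ultimately have "g = 0 \<or> g = sqrt (real a) \<or> g = - sqrt (real a)"
    using a by (auto simp: field_simps)
  then show ?thesis
    unfolding g_def[symmetric] by auto
qed

section \<open>The bound on the number of matrices\<close>

theorem theorem4p1:
  fixes d l f :: nat and W :: "nat \<Rightarrow> real mat"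
  assumes "d \<noteq> 2"
    and "real l = real d / 2"
    and "inj_on W {1..f}"
    and "mutually_quasi_unbiased d d l (2 * d) (W ` {1..f})"
  shows "f \<le> d"
proof -
  \<comment> \<open>As d = 2l is even and positive, excluding 2 leaves d > 2.\<close>
  have "0 < l"
    using assms(4) by (simp add: mutually_quasi_unbiased_def)
  moreover have "d = 2 * l"
    using assms(2) by linarith
  ultimately have d: "2 < d"
    using assms(1) by linarith
  have w: "weighing_matrix d d (W m)" if "m \<in> {1..f}" for m
    using assms(4) that by (simp add: mutually_quasi_unbiased_def)
  have qu: "quasi_unbiased d d l (2 * d) (W m) (W m')"
    if "m \<in> {1..f}" "m' \<in> {1..f}" "m \<noteq> m'" for m m'
    using assms(3,4) that
    by (auto simp: mutually_quasi_unbiased_def pairwise_def inj_on_eq_iff)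
  \<comment> \<open>A pair (m, r) stands for row r of \<open>W m\<close>. Two rows of one matrix are
    orthogonal; rows of different matrices have squared inner product 0 or 2d.\<close>
  have "card ({1..f} \<times> {..<d}) \<le> (card {..<d})\<^sup>2"
  proof (rule card_sign_vectors_le[where x = "\<lambda>(m, r) i. W m $$ (r, i)"])
    fix p q
    assume pq: "p \<in> {1..f} \<times> {..<d}" "q \<in> {1..f} \<times> {..<d}" "p \<noteq> q"
    obtain m r m' s where eq: "p = (m, r)" "q = (m', s)"
      by fastforce
    show "(\<Sum>i<d. (case p of (m, r) \<Rightarrow> \<lambda>i. W m $$ (r, i)) i *
        (case q of (m, r) \<Rightarrow> \<lambda>i. W m $$ (r, i)) i)\<^sup>2 \<in> {0, 2 * real (card {..<d})}"
    proof (cases "m = m'")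
      case True
      then show ?thesis
        using pq eq weighing_matrix_rows[OF w, of m r s] by auto
    next
      case False
      then show ?thesis
        using pq eq quasi_unbiased_rows[OF qu, of m m' r s] by auto
    qed
  next
    fix p i
    assume "p \<in> {1..f} \<times> {..<d}" "i \<in> {..<d}"
    then show "(case p of (m, r) \<Rightarrow> \<lambda>i. W m $$ (r, i)) i *
        (case p of (m, r) \<Rightarrow> \<lambda>i. W m $$ (r, i)) i = 1"
      using weighing_matrix_full_weight_entry_square[OF w] by (auto simp: split_beta)
  qed (use d in auto)
  then have "f * d \<le> d * d"
    by (simp add: power2_eq_square)
  then show ?thesis
    using d by simp
qed

end
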